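(* Let $X^2,Y^2$ be Banach spaces, and let $X^1\subset X^2$, $Y^1\subset Y^2$ be closed linear subspaces with inclusions $\iota_X:X^1\to X^2$, $\iota_Y:Y^1\to Y^2$. Let $U^2$ be an open neighborhood in $X^2$ of some $x_0\in X^1$, let $U^1=U^2\cap X^1$, and for $i=1,2$ let $S^i:U^i\to Y^i$ be a $C^1$ map with $S^i(x_0)=0$, such that $\iota_Y\circ S^1=S^2\circ\iota_X$ on $U^1$. Assume that $L^i:=dS^i|_{x_0}:X^i\to Y^i$ is Fredholm for $i=1,2$. Suppose that $\ker L^1=\ker L^2$, that $\operatorname{ran}L^1=\operatorname{ran}L^2\cap Y^1$, and that a linear subspace $W$ of $Y^1$ complements $\operatorname{ran}L^2$ in $Y^2$. Then there exists an open neighborhood $X_0^2\subset U^2$ of $x_0$ such that $S^2(x^2)=0$ for $x^2\in X^2_0$ implies $x^2\in X^1$.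
   Context: The superscripts $1,2$ are indices, not powers. $\ker$ and $\operatorname{ran}$ denote kernel and range. "$W$ complements $R$ in $Y$" means $Y=R\oplus W$ as a direct sum of linear subspaces. *)

theory Defs
  imports "HOL-Analysis.Analysis"
begin

text \<open>
  A closed linear subspace of a Banach space is a Banach space with the restricted norm, but it is
  a set and not a type. The notions below are therefore relative to linear subspaces \<open>X\<close>, \<open>Y\<close>
  of ambient types; a map on \<open>X\<close> is a total function whose values outside \<open>X\<close> are irrelevant.
  For \<open>X = Y = UNIV\<close> they reduce to the library notions, as the lemmas show.
\<close>

definition bounded_linear_between ::
  "'a::real_normed_vector set \<Rightarrow> 'b::real_normed_vector set \<Rightarrow> ('a \<Rightarrow> 'b) \<Rightarrow> bool" where
  "bounded_linear_between X Y L \<longleftrightarrow>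
     L ` X \<subseteq> Y \<and>
     (\<forall>x\<in>X. \<forall>y\<in>X. L (x + y) = L x + L y) \<and>
     (\<forall>c. \<forall>x\<in>X. L (c *\<^sub>R x) = c *\<^sub>R L x) \<and>
     (\<exists>K. \<forall>x\<in>X. norm (L x) \<le> K * norm x)"

lemma bounded_linear_between_UNIV: "bounded_linear_between UNIV UNIV L \<longleftrightarrow> bounded_linear L"
  by (auto simp: bounded_linear_between_def bounded_linear_def bounded_linear_axioms_def
      linear_iff mult.commute)

text \<open>
  Frechet derivative at \<open>x \<in> U\<close> of a map \<open>U \<rightarrow> Y\<close>, where \<open>U\<close> is a relatively open subset of \<open>X\<close>.
  The library's \<open>has_derivative\<close> is not used for proper subspaces: it would ask for a derivative
  that is bounded and linear on the whole ambient type, and its values would not have to lie in \<open>Y\<close>.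
\<close>

definition has_derivative_between ::
  "'a::real_normed_vector set \<Rightarrow> 'b::real_normed_vector set \<Rightarrow> 'a set \<Rightarrow> ('a \<Rightarrow> 'b) \<Rightarrow>
     ('a \<Rightarrow> 'b) \<Rightarrow> 'a \<Rightarrow> bool" where
  "has_derivative_between X Y U f D x \<longleftrightarrow>
     bounded_linear_between X Y D \<and>
     ((\<lambda>y. (f y - f x - D (y - x)) /\<^sub>R norm (y - x)) \<longlongrightarrow> 0) (at x within U)"

lemma has_derivative_between_UNIV:
  "has_derivative_between UNIV UNIV U f D x \<longleftrightarrow> (f has_derivative D) (at x within U)"
  by (simp add: has_derivative_between_def bounded_linear_between_UNIV has_derivative_at_within)

text \<open>
  The last conjunct is continuity of \<open>D\<close> for the operator norm of bounded linear maps \<open>X \<rightarrow> Y\<close>.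
\<close>

definition C1_map_between ::
  "'a::real_normed_vector set \<Rightarrow> 'b::real_normed_vector set \<Rightarrow> 'a set \<Rightarrow> ('a \<Rightarrow> 'b) \<Rightarrow> bool" where
  "C1_map_between X Y U f \<longleftrightarrow>
     f ` U \<subseteq> Y \<and>
     (\<exists>D. (\<forall>x\<in>U. has_derivative_between X Y U f (D x) x) \<and>
          (\<forall>x\<in>U. \<forall>e>0. \<exists>d>0. \<forall>z\<in>U. dist z x < d \<longrightarrow>
             (\<forall>h\<in>X. norm (D z h - D x h) \<le> e * norm h)))"

lemma C1_map_between_UNIV:
  assumes "open U"
  shows "C1_map_between UNIV UNIV U f \<longleftrightarrow>
    (\<exists>D. (\<forall>x\<in>U. (f has_derivative blinfun_apply (D x)) (at x)) \<and> continuous_on U D)"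
proof
  assume "C1_map_between UNIV UNIV U f"
  then obtain D where D': "\<forall>x\<in>U. (f has_derivative D x) (at x within U)"
    and C: "\<forall>x\<in>U. \<forall>e>0. \<exists>d>0. \<forall>z\<in>U. dist z x < d \<longrightarrow>
      (\<forall>h\<in>UNIV. norm (D z h - D x h) \<le> e * norm h)"
    unfolding C1_map_between_def has_derivative_between_UNIV by (elim conjE exE)
  have D: "(f has_derivative D x) (at x within U)" if "x \<in> U" for x
    using D' that by blast
  define B where "B x = Blinfun (D x)" for x
  have B: "blinfun_apply (B x) = D x" if "x \<in> U" for x
    unfolding B_def using D[OF that] by (simp add: bounded_linear_Blinfun_apply has_derivative_bounded_linear)
  have "continuous_on U B"
    unfolding continuous_on_iff
  proof (intro ballI allI impI)
    fix x and e :: real assume "x \<in> U" "e > 0"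
    then obtain d where d: "d > 0"
      "\<And>z h. z \<in> U \<Longrightarrow> dist z x < d \<Longrightarrow> norm (D z h - D x h) \<le> e/2 * norm h"
      using C[rule_format, of x "e/2"] by auto
    have "dist (B z) (B x) < e" if "z \<in> U" "dist z x < d" for z
    proof -
      have "norm (B z - B x) \<le> e/2"
        using d(2)[OF that] \<open>e > 0\<close>
        by (intro norm_blinfun_bound) (simp_all add: blinfun.diff_left B[OF \<open>x \<in> U\<close>] B[OF that(1)])
      then show ?thesis using \<open>e > 0\<close> by (simp add: dist_norm)
    qed
    then show "\<exists>d>0. \<forall>z\<in>U. dist z x < d \<longrightarrow> dist (B z) (B x) < e" using d(1) by blast
  qed
  moreover have "\<forall>x\<in>U. (f has_derivative blinfun_apply (B x)) (at x)"
    using D B at_within_open[OF _ assms] by simp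
  ultimately show "\<exists>D. (\<forall>x\<in>U. (f has_derivative blinfun_apply (D x)) (at x)) \<and> continuous_on U D"
    by blast
next
  assume "\<exists>D. (\<forall>x\<in>U. (f has_derivative blinfun_apply (D x)) (at x)) \<and> continuous_on U D"
  then obtain D where D: "\<And>x. x \<in> U \<Longrightarrow> (f has_derivative blinfun_apply (D x)) (at x)"
    and C: "continuous_on U D" by blast
  have "\<exists>d>0. \<forall>z\<in>U. dist z x < d \<longrightarrow>
      (\<forall>h. norm (blinfun_apply (D z) h - blinfun_apply (D x) h) \<le> e * norm h)"
    if xe: "x \<in> U" "e > 0" for x and e :: real
  proof -
    obtain d where d: "d > 0" "\<And>z. z \<in> U \<Longrightarrow> dist z x < d \<Longrightarrow> dist (D z) (D x) < e"
      using C xe unfolding continuous_on_iff by blast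
    have "norm (blinfun_apply (D z) h - blinfun_apply (D x) h) \<le> e * norm h"
      if "z \<in> U" "dist z x < d" for z h
    proof -
      have "norm (blinfun_apply (D z - D x) h) \<le> norm (D z - D x) * norm h"
        by (rule norm_blinfun)
      also have "\<dots> \<le> e * norm h"
        using d(2)[OF that] by (intro mult_right_mono) (auto simp: dist_norm)
      finally show ?thesis by (simp add: blinfun.diff_left)
    qed
    then show ?thesis using d(1) by blast
  qed
  then show "C1_map_between UNIV UNIV U f"
    unfolding C1_map_between_def has_derivative_between_UNIV
    by (intro conjI exI[of _ "\<lambda>x. blinfun_apply (D x)"])
      (simp_all add: D has_derivative_at_withinI)
qed

definition ker_on :: "'a set \<Rightarrow> ('a \<Rightarrow> 'b::zero) \<Rightarrow> 'a set" where
  "ker_on X L = {x \<in> X. L x = 0}"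

text \<open>
  Finite-dimensional kernel and cokernel; the cokernel \<open>Y / L ` X\<close> is finite-dimensional iff \<open>Y\<close> is
  spanned by the range together with finitely many vectors. Closedness of the range is not required,
  since it is automatic for Banach spaces.
\<close>

definition Fredholm_between ::
  "'a::real_normed_vector set \<Rightarrow> 'b::real_normed_vector set \<Rightarrow> ('a \<Rightarrow> 'b) \<Rightarrow> bool" where
  "Fredholm_between X Y L \<longleftrightarrow>
     bounded_linear_between X Y L \<and>
     (\<exists>B. finite B \<and> ker_on X L \<subseteq> span B) \<and>
     (\<exists>B. finite B \<and> B \<subseteq> Y \<and> span (L ` X \<union> B) = Y)"

definition complements_in :: "'a::real_vector set \<Rightarrow> 'a set \<Rightarrow> 'a set \<Rightarrow> bool" where
  "complements_in W R Y \<longleftrightarrow>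
     subspace R \<and> subspace W \<and> R \<inter> W = {0} \<and> Y = {r + w | r w. r \<in> R \<and> w \<in> W}"

end

theory Submission
  imports Defs
begin

text \<open>
  No zero of \<open>S2\<close> close to \<open>x0\<close> can have a positive distance to \<open>X1\<close>. Suppose that \<open>S2 x = 0\<close>, that
  \<open>x\<close> is close to \<open>x0\<close> and that \<open>x \<notin> X1\<close>. As \<open>X1\<close> is closed, \<open>x\<close> has an almost nearest point \<open>x'\<close> in
  \<open>X1\<close>, with \<open>norm (x - x') < 2 * infdist x X1\<close>, and \<open>x'\<close> is close to \<open>x0\<close> too. Since \<open>S2\<close> is
  continuously differentiable, the error \<open>e = S2 x - S2 x' - L2 (x - x')\<close> is as small a multiple of
  \<open>norm (x - x')\<close> as desired (\<open>C1_map_strictly_differentiable\<close>). An open mapping theorem modulo \<open>W\<close>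
  (\<open>bounded_preimage_modulo_closed_subspace\<close>) writes \<open>e = L2 u + w\<close> with \<open>w \<in> W\<close> and
  \<open>norm u \<le> C * norm e\<close>, so that \<open>norm u < infdist x X1\<close>.

  Now \<open>L2 (x - x' + u) = - S2 x' - w\<close> lies in \<open>Y1\<close>, because \<open>S2 x' = S1 x'\<close> and \<open>W \<subseteq> Y1\<close>; hence it
  lies in \<open>range L2 \<inter> Y1 = L1 ` X1\<close>. As \<open>L1\<close> and \<open>L2\<close> agree on \<open>X1\<close>
  (\<open>derivative_between_restriction\<close>), \<open>x - x' + u\<close> differs from a point of \<open>X1\<close> by an element of the
  common kernel, which is contained in \<open>X1\<close>. So \<open>x + u \<in> X1\<close>, and \<open>x\<close> has distance at most \<open>norm u\<close>
  from \<open>X1\<close>, a contradiction.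

  Boundedness of \<open>u\<close> in terms of \<open>e\<close> needs \<open>W\<close> to be closed. It is, because the cokernel of \<open>L2\<close>
  is finite-dimensional and a finite-dimensional subspace of a normed space is closed.
\<close>

section \<open>Finite-dimensional subspaces and complements\<close>

text \<open>
  If \<open>v\<close> has distance \<open>d > 0\<close> from \<open>span S\<close>, then \<open>\<bar>c\<bar> * d \<le> norm (c *\<^sub>R v + m)\<close> for all
  \<open>m \<in> span S\<close>. The \<open>v\<close>-coefficients of a convergent sequence are therefore Cauchy, and the limit
  can be taken in both summands separately.
\<close>

lemma closed_span_insert:
  fixes S :: "'a::real_normed_vector set"
  assumes "closed (span S)"
  shows "closed (span (insert v S))"
proof (cases "v \<in> span S")
  case True
  then show ?thesis using assms by (simp add: span_redundant)
next
  case False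
  define d where "d = infdist v (span S)"
  have "span S \<noteq> {}" using span_zero by blast
  then have d: "d > 0"
    unfolding d_def by (intro infdist_pos_not_in_closed assms False)
  have bound: "\<bar>c\<bar> * d \<le> norm (c *\<^sub>R v + m)" if "m \<in> span S" for c m
  proof (cases "c = 0")
    case False
    have "- ((1 / c) *\<^sub>R m) \<in> span S"
      using that by (intro span_neg span_mul)
    then have "d \<le> norm (v + (1 / c) *\<^sub>R m)"
      using infdist_le[of _ "span S" v] by (fastforce simp: d_def dist_norm)
    then have "\<bar>c\<bar> * d \<le> norm (c *\<^sub>R (v + (1 / c) *\<^sub>R m))"
      by (simp add: mult_left_mono)
    also have "c *\<^sub>R (v + (1 / c) *\<^sub>R m) = c *\<^sub>R v + m"
      using False by (simp add: scaleR_add_right)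
    finally show ?thesis .
  qed simp
  show ?thesis
    unfolding closed_sequential_limits
  proof (intro allI impI, elim conjE)
    fix y l assume "\<forall>n. y n \<in> span (insert v S)" and lim: "y \<longlonglongrightarrow> l"
    then obtain c where c: "\<And>n. y n - c n *\<^sub>R v \<in> span S"
      unfolding span_breakdown_eq by metis
    have diff: "\<bar>c m - c n\<bar> * d \<le> dist (y m) (y n)" for m n
      using bound[OF span_diff[OF c[of m] c[of n]], of "c m - c n"]
      by (simp add: dist_norm algebra_simps)
    have "Cauchy c"
    proof (rule metric_CauchyI)
      fix e :: real assume "e > 0"
      then obtain M where M: "\<And>m n. m \<ge> M \<Longrightarrow> n \<ge> M \<Longrightarrow> dist (y m) (y n) < e * d"
        using metric_CauchyD[OF LIMSEQ_imp_Cauchy[OF lim], of "e * d"] d by auto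
      have "dist (c m) (c n) < e" if "m \<ge> M" "n \<ge> M" for m n
        using le_less_trans[OF diff M[OF that]] d by (simp add: dist_real_def)
      then show "\<exists>M. \<forall>m\<ge>M. \<forall>n\<ge>M. dist (c m) (c n) < e" by blast
    qed
    then obtain a where "c \<longlonglongrightarrow> a"
      by (auto simp: Cauchy_convergent_iff convergent_def)
    then have "(\<lambda>n. y n - c n *\<^sub>R v) \<longlonglongrightarrow> l - a *\<^sub>R v"
      by (intro tendsto_intros lim)
    then have "l - a *\<^sub>R v \<in> span S"
      by (rule closed_sequentially[OF assms c])
    then show "l \<in> span (insert v S)"
      unfolding span_breakdown_eq by blast
  qed
qed

lemma closed_span_finite:
  fixes S :: "'a::real_normed_vector set"
  assumes "finite S"
  shows "closed (span S)"
  using assms by induction (simp_all add: closed_span_insert)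

text \<open>
  The projections to \<open>W\<close> of finitely many vectors that span the space together with \<open>R\<close> span \<open>W\<close>.
\<close>

lemma complement_of_finite_codim_finite_span:
  assumes W: "complements_in W R UNIV"
    and B: "finite B" "span (R \<union> B) = UNIV"
  shows "\<exists>B'. finite B' \<and> W = span B'"
proof -
  have R: "subspace R" and sW: "subspace W" and RW: "R \<inter> W = {0}"
    and sum: "\<exists>r w. y = r + w \<and> r \<in> R \<and> w \<in> W" for y
    using W unfolding complements_in_def by blast+
  obtain p where p: "\<And>y. p y \<in> W" "\<And>y. y - p y \<in> R"
    using sum by (metis add_diff_cancel_right')
  have sub: "span (p ` B) \<subseteq> W"
    using sW p(1) by (intro span_minimal) auto
  have "W \<subseteq> span (p ` B)"
  proof
    fix w assume w: "w \<in> W"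
    let ?V = "{r + s |r s. r \<in> R \<and> s \<in> span (p ` B)}"
    have "b \<in> ?V" if "b \<in> B" for b
      using p(2)[of b] span_base[of "p b" "p ` B"] that
      by (intro CollectI exI[of _ "b - p b"] exI[of _ "p b"]) auto
    moreover have "r \<in> ?V" if "r \<in> R" for r
      using that span_zero by force
    ultimately have "span (R \<union> B) \<subseteq> ?V"
      by (intro span_minimal subspace_sums R subspace_span) blast
    then obtain r s where rs: "w = r + s" "r \<in> R" "s \<in> span (p ` B)"
      using B(2) by blast
    then have "r \<in> W"
      using sub w sW subspace_diff[of W w s] by auto
    then have "r = 0" using RW rs(2) by blast
    then show "w \<in> span (p ` B)" using rs by simp
  qed
  then show ?thesis using sub B(1) by blast
qed

section \<open>The open mapping theorem modulo a closed subspace\<close>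

text \<open>
  The Baire category part of the open mapping theorem. The sets \<open>A n\<close> of values attained modulo \<open>W\<close>
  on the ball of radius \<open>n\<close> exhaust the Banach space, so the closure of one of them contains a ball;
  taking differences moves its centre to \<open>0\<close>, and homogeneity gives the claim for vectors of any
  norm. The factor \<open>1 / 2\<close> makes the errors summable when the approximation is iterated.
\<close>

lemma approximate_preimage_modulo_subspace:
  fixes L :: "'a::real_normed_vector \<Rightarrow> 'b::banach"
  assumes L: "bounded_linear L" and W: "subspace W"
    and onto: "\<And>y. \<exists>x. y - L x \<in> W"
  shows "\<exists>K>0. \<forall>y. \<exists>x. \<exists>w\<in>W. norm x \<le> K * norm y \<and> norm (y - L x - w) \<le> norm y / 2"
proof -
  interpret L: bounded_linear L by fact
  define A where "A n = {y. \<exists>x. norm x \<le> real n \<and> y - L x \<in> W}" for n :: nat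
  have "\<exists>n. interior (closure (A n)) \<noteq> {}"
  proof (rule ccontr)
    assume "\<not> ?thesis"
    then have "euclidean interior_of \<Union>(range (\<lambda>n. closure (A n))) = {}"
      by (intro Baire_category_alt) (auto simp: completely_metrizable_space_euclidean)
    moreover have "y \<in> \<Union>(range (\<lambda>n. closure (A n)))" for y
    proof -
      obtain x where "y - L x \<in> W" using onto by blast
      then have "y \<in> A (nat \<lceil>norm x\<rceil>)"
        unfolding A_def by (auto intro!: exI[of _ x] simp: real_nat_ceiling_ge)
      then show ?thesis using closure_subset by blast
    qed
    ultimately have "interior (UNIV :: 'b set) = {}"
      by (metis UNIV_eq_I euclidean_interior_of)
    then show False by simp
  qed
  then obtain n y0 where "y0 \<in> interior (closure (A n))" by blast
  then obtain r where r: "r > 0" "ball y0 r \<subseteq> closure (A n)"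
    unfolding mem_interior by blast
  \<comment> \<open>Approximating both \<open>y0 + z\<close> and \<open>y0\<close> to within \<open>r / 8\<close> approximates \<open>z\<close> to within \<open>r / 4\<close>,
    which is half the norm of the vectors of length \<open>r / 2\<close> used for rescaling below.\<close>
  have approx: "\<exists>x. \<exists>w\<in>W. norm x \<le> 2 * real n \<and> norm (z - L x - w) \<le> r / 4"
    if z: "norm z < r" for z
  proof -
    have "y0 + z \<in> closure (A n)" "y0 \<in> closure (A n)"
      using r z by (auto simp: dist_norm intro!: subsetD[OF r(2)])
    then obtain a b where ab: "a \<in> A n" "dist a (y0 + z) < r / 8" "b \<in> A n" "dist b y0 < r / 8"
      using r(1) unfolding closure_approachable by (metis divide_pos_pos zero_less_numeral)
    then obtain u v where uv: "norm u \<le> real n" "a - L u \<in> W" "norm v \<le> real n" "b - L v \<in> W"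
      unfolding A_def by blast
    have "norm (u - v) \<le> 2 * real n"
      using uv norm_triangle_ineq4[of u v] by simp
    moreover have "(a - L u) - (b - L v) \<in> W"
      by (intro subspace_diff[OF W] uv)
    moreover have "norm (z - L (u - v) - ((a - L u) - (b - L v))) \<le> r / 4"
    proof -
      have eq: "z - L (u - v) - ((a - L u) - (b - L v)) = (b - y0) - (a - (y0 + z))"
        by (simp add: L.diff)
      show ?thesis
        using ab norm_triangle_ineq4[of "b - y0" "a - (y0 + z)"]
        unfolding eq dist_norm by linarith
    qed
    ultimately show ?thesis by blast
  qed
  \<comment> \<open>Rescaling \<open>y\<close> to length \<open>r / 2\<close> costs the factor \<open>2 / r\<close> in \<open>2 * n * (2 / r)\<close>; the summand \<open>1\<close>
    keeps \<open>K\<close> positive if \<open>n = 0\<close>.\<close>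
  define K where "K = 4 * real n / r + 1"
  have "K > 0" using r(1) by (simp add: K_def add_nonneg_pos)
  moreover have "\<exists>x. \<exists>w\<in>W. norm x \<le> K * norm y \<and> norm (y - L x - w) \<le> norm y / 2" for y
  proof (cases "y = 0")
    case True
    then show ?thesis
      using subspace_0[OF W] by (intro exI[of _ 0] bexI[of _ 0]) (auto simp: L.zero)
  next
    case False
    define t where "t = r / (2 * norm y)"
    have t: "t > 0" using False r(1) by (simp add: t_def)
    have "norm (t *\<^sub>R y) < r" using False r(1) by (simp add: t_def)
    then obtain x w where xw: "w \<in> W" "norm x \<le> 2 * real n" "norm (t *\<^sub>R y - L x - w) \<le> r / 4"
      using approx by blast
    have "norm ((1 / t) *\<^sub>R x) \<le> (1 / t) * (2 * real n)"
      using t xw(2) by (simp add: divide_right_mono)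
    also have "\<dots> \<le> K * norm y"
      using r(1) by (simp add: t_def K_def field_simps)
    finally have "norm ((1 / t) *\<^sub>R x) \<le> K * norm y" .
    moreover have "norm (y - L ((1 / t) *\<^sub>R x) - (1 / t) *\<^sub>R w) \<le> norm y / 2"
    proof -
      have "y - L ((1 / t) *\<^sub>R x) - (1 / t) *\<^sub>R w = (1 / t) *\<^sub>R (t *\<^sub>R y - L x - w)"
        using t by (simp add: L.scaleR scaleR_diff_right)
      then have "norm (y - L ((1 / t) *\<^sub>R x) - (1 / t) *\<^sub>R w) = (1 / t) * norm (t *\<^sub>R y - L x - w)"
        using t by simp
      also have "\<dots> \<le> (1 / t) * (r / 4)"
        using t xw(3) by (intro mult_left_mono) auto
      also have "\<dots> = norm y / 2" using r(1) by (simp add: t_def)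
      finally show ?thesis .
    qed
    moreover have "(1 / t) *\<^sub>R w \<in> W" using W xw(1) by (rule subspace_scale)
    ultimately show ?thesis by blast
  qed
  ultimately show ?thesis by blast
qed

text \<open>
  Approximate preimages of the successive errors \<open>z n\<close> form an absolutely convergent series, since
  \<open>norm (z n) \<le> norm y / 2 ^ n\<close>. The parts in \<open>W\<close> that are split off along the way are not controlled
  in norm; their sum still converges to an element of \<open>W\<close>, because \<open>W\<close> is closed and all other terms
  converge. This amounts to the open mapping theorem for the map that \<open>L\<close> induces into the quotient
  by \<open>W\<close>.
\<close>

lemma bounded_preimage_modulo_closed_subspace:
  fixes L :: "'a::banach \<Rightarrow> 'b::banach"
  assumes L: "bounded_linear L" and W: "subspace W" "closed W"
    and onto: "\<And>y. \<exists>x. y - L x \<in> W"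
  shows "\<exists>C>0. \<forall>y. \<exists>x. norm x \<le> C * norm y \<and> y - L x \<in> W"
proof -
  interpret L: bounded_linear L by fact
  obtain K where K: "K > 0"
    "\<forall>y. \<exists>x. \<exists>w\<in>W. norm x \<le> K * norm y \<and> norm (y - L x - w) \<le> norm y / 2"
    using approximate_preimage_modulo_subspace[OF L W(1) onto] by blast
  then obtain g h where gh: "\<And>y. norm (g y) \<le> K * norm y" "\<And>y. h y \<in> W"
    "\<And>y. norm (y - L (g y) - h y) \<le> norm y / 2"
    by metis
  have "\<exists>x. norm x \<le> 2 * K * norm y \<and> y - L x \<in> W" for y
  proof -
    define z where "z n = ((\<lambda>y. y - L (g y) - h y) ^^ n) y" for n
    have z_Suc: "z (Suc n) = z n - L (g (z n)) - h (z n)" for n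
      by (simp add: z_def)
    have z_bound: "norm (z n) \<le> norm y * (1 / 2) ^ n" for n
    proof (induction n)
      case (Suc n)
      then show ?case using gh(3)[of "z n"] by (simp add: z_Suc)
    qed (simp add: z_def)
    have g_bound: "norm (g (z n)) \<le> K * norm y * (1 / 2) ^ n" for n
      using order_trans[OF gh(1) mult_left_mono[OF z_bound[of n], of K]] K(1)
      by (simp add: mult.assoc)
    have geo: "(\<lambda>n. K * norm y * (1 / 2) ^ n) sums (2 * K * norm y)"
      using sums_mult[OF geometric_sums[of "1 / 2 :: real"], of "K * norm y"]
      by (simp add: mult_ac)
    have sg: "summable (\<lambda>n. norm (g (z n)))"
      using g_bound by (intro summable_comparison_test'[OF sums_summable[OF geo]]) simp
    define x where "x = (\<Sum>n. g (z n))"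
    have "norm x \<le> (\<Sum>n. norm (g (z n)))"
      unfolding x_def using sg by (rule summable_norm)
    also have "\<dots> \<le> 2 * K * norm y"
      using suminf_le[OF g_bound sg sums_summable[OF geo]] sums_unique[OF geo] by simp
    finally have "norm x \<le> 2 * K * norm y" .
    moreover have "y - L x \<in> W"
    proof (rule closed_sequentially[OF W(2)])
      show "y - z n - L (\<Sum>k<n. g (z k)) \<in> W" for n
      proof (induction n)
        case 0
        then show ?case using subspace_0[OF W(1)] by (simp add: z_def L.zero)
      next
        case (Suc n)
        then show ?case
          using subspace_add[OF W(1) Suc gh(2)[of "z n"]]
          by (simp add: z_Suc L.add algebra_simps)
      qed
      have "(\<lambda>n. norm y * (1 / 2) ^ n) \<longlonglongrightarrow> norm y * 0"
        by (intro tendsto_mult tendsto_const LIMSEQ_realpow_zero) auto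
      then have "z \<longlonglongrightarrow> 0"
        using z_bound by (intro Lim_null_comparison[of z]) auto
      moreover have "(\<lambda>n. \<Sum>k<n. g (z k)) \<longlonglongrightarrow> x"
        unfolding x_def using summable_LIMSEQ[OF summable_norm_cancel[OF sg]] .
      ultimately have "(\<lambda>n. y - z n - L (\<Sum>k<n. g (z k))) \<longlonglongrightarrow> y - 0 - L x"
        by (intro tendsto_intros L.tendsto)
      then show "(\<lambda>n. y - z n - L (\<Sum>k<n. g (z k))) \<longlonglongrightarrow> y - L x" by simp
    qed
    ultimately show ?thesis by blast
  qed
  then show ?thesis using K(1) by (intro exI[of _ "2 * K"]) simp
qed

section \<open>Derivatives\<close>

text \<open>
  On a small ball, where the derivative differs from \<open>L\<close> by at most \<open>e\<close> in norm, the mean value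
  inequality for \<open>f - L\<close> gives the bound uniformly in both points, not just with one of them
  at \<open>x0\<close>.
\<close>

lemma C1_map_strictly_differentiable:
  fixes f :: "'a::real_normed_vector \<Rightarrow> 'b::real_normed_vector"
  assumes U: "open U" "x0 \<in> U" and f: "C1_map_between UNIV UNIV U f"
    and L: "(f has_derivative L) (at x0)" and "e > 0"
  shows "\<exists>d>0. ball x0 d \<subseteq> U \<and>
    (\<forall>a\<in>ball x0 d. \<forall>b\<in>ball x0 d. norm (f b - f a - L (b - a)) \<le> e * norm (b - a))"
proof -
  obtain D where D: "\<And>x. x \<in> U \<Longrightarrow> (f has_derivative blinfun_apply (D x)) (at x)"
    and cont: "continuous_on U D"
    using f unfolding C1_map_between_UNIV[OF U(1)] by blast
  have L_eq: "L = blinfun_apply (D x0)"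
    using has_derivative_unique[OF L D[OF U(2)]] .
  obtain d1 where d1: "d1 > 0" "ball x0 d1 \<subseteq> U"
    using U open_contains_ball by blast
  obtain d2 where d2: "d2 > 0" "\<And>x. x \<in> U \<Longrightarrow> dist x x0 < d2 \<Longrightarrow> dist (D x) (D x0) < e"
    using cont U(2) \<open>e > 0\<close> unfolding continuous_on_iff by blast
  define d where "d = min d1 d2"
  have d: "d > 0" "ball x0 d \<subseteq> U" using d1 d2 by (auto simp: d_def)
  have "norm (f b - f a - L (b - a)) \<le> e * norm (b - a)"
    if ab: "a \<in> ball x0 d" "b \<in> ball x0 d" for a b
  proof -
    have "norm (f b - f a - blinfun_apply (D x0) (b - a)) \<le> norm (b - a) * e"
    proof (rule differentiable_bound_linearization[where S = "ball x0 d" and ?x0.0 = x0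
          and f' = "\<lambda>x. blinfun_apply (D x)"])
      show "a + t *\<^sub>R (b - a) \<in> ball x0 d" if "t \<in> {0..1}" for t
        using convexD_alt[OF convex_ball ab, of t] that by (simp add: algebra_simps)
      show "(f has_derivative blinfun_apply (D x)) (at x within ball x0 d)"
        if "x \<in> ball x0 d" for x
        using D d(2) that has_derivative_at_withinI by blast
      show "onorm (blinfun_apply (D x) - blinfun_apply (D x0)) \<le> e"
        if "x \<in> ball x0 d" for x
      proof -
        have "norm (D x - D x0) \<le> e"
          using d2(2)[of x] that d(2) by (auto simp: d_def dist_norm dist_commute norm_minus_commute)
        then show ?thesis by (simp add: norm_blinfun.rep_eq minus_blinfun.rep_eq fun_diff_def)
      qed
      show "x0 \<in> ball x0 d" using d(1) by simp
    qed
    then show ?thesis by (simp add: L_eq mult.commute)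
  qed
  then show ?thesis using d by blast
qed

text \<open>
  Both derivatives at \<open>h\<close> are the limit of the same difference quotients along the ray
  \<open>x0 + t *\<^sub>R h\<close>, which stays in \<open>X\<close>, and in \<open>U\<close> for small \<open>t\<close>.
\<close>

lemma derivative_between_restriction:
  fixes f g :: "'a::real_normed_vector \<Rightarrow> 'b::real_normed_vector"
  assumes X: "subspace X" "x0 \<in> X" and U: "open U" "x0 \<in> U"
    and M: "has_derivative_between X Y (U \<inter> X) f M x0"
    and L: "(g has_derivative L) (at x0)"
    and eq: "\<forall>x\<in>U \<inter> X. f x = g x" and h: "h \<in> X"
  shows "M h = L h"
proof (cases "h = 0")
  case True
  have "M (0 *\<^sub>R 0) = 0 *\<^sub>R M 0"
    using M subspace_0[OF X(1)]
    unfolding has_derivative_between_def bounded_linear_between_def by blast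
  then show ?thesis
    using True linear_0[OF bounded_linear.linear[OF has_derivative_bounded_linear[OF L]]] by simp
next
  case False
  have L': "bounded_linear L" using L by (rule has_derivative_bounded_linear)
  have M_scale: "M (c *\<^sub>R h) = c *\<^sub>R M h" for c
    using M h unfolding has_derivative_between_def bounded_linear_between_def by blast
  have lim1: "((\<lambda>y. (f y - f x0 - M (y - x0)) /\<^sub>R norm (y - x0)) \<longlongrightarrow> 0) (at x0 within U \<inter> X)"
    using M unfolding has_derivative_between_def by blast
  have "(g has_derivative L) (at x0 within U \<inter> X)"
    using L by (rule has_derivative_at_withinI)
  then have "((\<lambda>y. (g y - g x0 - L (y - x0)) /\<^sub>R norm (y - x0)) \<longlongrightarrow> 0) (at x0 within U \<inter> X)"
    by (simp add: has_derivative_at_within)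
  from tendsto_diff[OF this lim1]
  have lim: "((\<lambda>y. (g y - g x0 - L (y - x0)) /\<^sub>R norm (y - x0) -
      (f y - f x0 - M (y - x0)) /\<^sub>R norm (y - x0)) \<longlongrightarrow> 0) (at x0 within U \<inter> X)" by simp
  define p where "p t = x0 + t *\<^sub>R h" for t :: real
  have p_lim: "(p \<longlongrightarrow> x0) (at_right 0)"
    unfolding p_def by (auto intro!: tendsto_eq_intros)
  have ev: "eventually (\<lambda>t. p t \<in> U \<and> t > 0) (at_right 0)"
    using topological_tendstoD[OF p_lim U] eventually_at_right_less[of "0::real"]
    by (rule eventually_conj)
  have pX: "p t \<in> X" for t
    unfolding p_def using X h by (intro subspace_add subspace_scale)
  have "filterlim p (at x0 within U \<inter> X) (at_right 0)"
    unfolding filterlim_at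
    by (intro conjI p_lim eventually_mono[OF ev]) (use pX False in \<open>auto simp: p_def\<close>)
  from filterlim_compose[OF lim this]
  have "((\<lambda>t. (M h - L h) /\<^sub>R norm h) \<longlongrightarrow> 0) (at_right (0::real))"
  proof (rule Lim_transform_eventually)
    show "\<forall>\<^sub>F t in at_right 0. (g (p t) - g x0 - L (p t - x0)) /\<^sub>R norm (p t - x0) -
      (f (p t) - f x0 - M (p t - x0)) /\<^sub>R norm (p t - x0) = (M h - L h) /\<^sub>R norm h"
      using ev
    proof eventually_elim
      case (elim t)
      have "f (p t) = g (p t)" "f x0 = g x0" using eq elim pX X U by auto
      moreover have "p t - x0 = t *\<^sub>R h" by (simp add: p_def)
      ultimately show ?case using elim
        by (simp add: M_scale linear_scale[OF bounded_linear.linear[OF L']]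
            scaleR_diff_right[symmetric] divide_simps)
    qed
  qed
  then have "(M h - L h) /\<^sub>R norm h = 0"
    by (simp add: tendsto_const_iff)
  then show ?thesis using False by simp
qed

section \<open>Zeros near \<open>x0\<close> lie in the subspace\<close>

theorem lemma3p1:
  fixes X1 U1 U2 :: "'x::banach set"
    and Y1 W :: "'y::banach set"
    and S1 S2 L1 L2 :: "'x \<Rightarrow> 'y"
    and x0 :: 'x
  assumes X1: "subspace X1" "closed X1"
    and Y1: "subspace Y1" "closed Y1"
    and x0: "x0 \<in> X1"
    and U2: "open U2" "x0 \<in> U2"
    and U1: "U1 = U2 \<inter> X1"
    and S1: "C1_map_between X1 Y1 U1 S1" "S1 x0 = 0"
    and S2: "C1_map_between UNIV UNIV U2 S2" "S2 x0 = 0"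
    and S1_S2: "\<forall>x\<in>U1. S1 x = S2 x"
    and L1: "has_derivative_between X1 Y1 U1 S1 L1 x0" "Fredholm_between X1 Y1 L1"
    and L2: "has_derivative_between UNIV UNIV U2 S2 L2 x0" "Fredholm_between UNIV UNIV L2"
    and ker_eq: "ker_on X1 L1 = ker_on UNIV L2"
    and ran_eq: "L1 ` X1 = range L2 \<inter> Y1"
    and W: "subspace W" "W \<subseteq> Y1" "complements_in W (range L2) UNIV"
  shows "\<exists>X0. open X0 \<and> x0 \<in> X0 \<and> X0 \<subseteq> U2 \<and> (\<forall>x\<in>X0. S2 x = 0 \<longrightarrow> x \<in> X1)"
proof -
  have L2': "(S2 has_derivative L2) (at x0)"
    using L2(1) unfolding has_derivative_between_UNIV at_within_open[OF U2(2,1)] .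
  then interpret L2: bounded_linear L2
    by (rule has_derivative_bounded_linear)
  have L1_eq: "L1 h = L2 h" if "h \<in> X1" for h
    using derivative_between_restriction[OF X1(1) x0 U2 L1(1)[unfolded U1] L2' _ that] S1_S2 U1 by simp
  have "\<exists>B. finite B \<and> W = span B"
    using L2(2) complement_of_finite_codim_finite_span[OF W(3)]
    unfolding Fredholm_between_def by blast
  then have "closed W" using closed_span_finite by auto
  moreover have "\<exists>x. y - L2 x \<in> W" for y
  proof -
    have "y \<in> {r + w |r w. r \<in> range L2 \<and> w \<in> W}"
      using W(3) unfolding complements_in_def by blast
    then obtain x w where "y = L2 x + w" "w \<in> W" by blast
    then have "y - L2 x \<in> W" by simp
    then show ?thesis by blast
  qed
  ultimately obtain C where C: "C > 0" "\<And>y. \<exists>u. norm u \<le> C * norm y \<and> y - L2 u \<in> W"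
    using bounded_preimage_modulo_closed_subspace[OF L2.bounded_linear_axioms W(1)] by blast
  \<comment> \<open>With the factor \<open>1 / (2 * C)\<close>, the correction \<open>u\<close> has at most half the norm of \<open>x - x'\<close>.\<close>
  obtain d where d: "d > 0" "ball x0 d \<subseteq> U2"
    and strict: "\<And>a b. a \<in> ball x0 d \<Longrightarrow> b \<in> ball x0 d \<Longrightarrow>
      norm (S2 b - S2 a - L2 (b - a)) \<le> 1 / (2 * C) * norm (b - a)"
    using C1_map_strictly_differentiable[OF U2 S2(1) L2', of "1 / (2 * C)"] C(1) by auto
  \<comment> \<open>The almost nearest point \<open>x'\<close> satisfies \<open>dist x x' < 2 * dist x x0\<close>, so radius \<open>d / 3\<close> for \<open>x\<close>
    keeps \<open>x'\<close> within \<open>d\<close> of \<open>x0\<close>.\<close>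
  have "x \<in> X1" if x: "x \<in> ball x0 (d / 3)" "S2 x = 0" for x
  proof (rule ccontr)
    assume "x \<notin> X1"
    then have pos: "infdist x X1 > 0"
      using X1 x0 by (intro infdist_pos_not_in_closed) auto
    have "X1 \<noteq> {}" using x0 by blast
    moreover have "infdist x X1 < 2 * infdist x X1" using pos by simp
    ultimately have "Inf (dist x ` X1) < 2 * infdist x X1"
      by (simp add: infdist_notempty)
    with \<open>X1 \<noteq> {}\<close> obtain x' where x': "x' \<in> X1" "dist x x' < 2 * infdist x X1"
      using cInf_lessD[of "dist x ` X1"] by blast
    have "dist x x' < 2 * dist x x0"
      using x'(2) infdist_le[OF x0, of x] by simp
    then have balls: "x' \<in> ball x0 d" "x \<in> ball x0 d"
      using x(1) d(1) dist_triangle[of x0 x' x] by (auto simp: dist_commute)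
    have S2x': "S2 x' \<in> Y1"
      using S1(1) S1_S2 balls(1) d(2) x'(1)
      unfolding C1_map_between_def U1 by (metis IntI image_subset_iff subsetD)
    define e where "e = S2 x - S2 x' - L2 (x - x')"
    obtain u where u: "norm u \<le> C * norm e" "e - L2 u \<in> W"
      using C(2) by blast
    have "norm u \<le> C * (1 / (2 * C) * norm (x - x'))"
      using u(1) mult_left_mono[OF strict[OF balls], of C] C(1) by (simp add: e_def)
    also have "\<dots> < infdist x X1"
      using x'(2) C(1) by (simp add: dist_norm)
    finally have small: "norm u < infdist x X1" .
    have "L2 (x - x' + u) = - S2 x' - (e - L2 u)"
      by (simp add: e_def x(2) L2.add)
    also have "\<dots> \<in> Y1"
      by (intro subspace_diff[OF Y1(1)] subspace_neg[OF Y1(1)] S2x' subsetD[OF W(2) u(2)])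
    finally have "L2 (x - x' + u) \<in> L1 ` X1"
      using ran_eq by blast
    then obtain h where h: "h \<in> X1" "L2 (x - x' + u) = L2 h"
      using L1_eq by auto
    have "x - x' + u - h \<in> ker_on UNIV L2"
      using h(2) unfolding ker_on_def by (simp add: L2.diff)
    then have "x - x' + u - h \<in> ker_on X1 L1"
      by (simp only: ker_eq)
    then have "x - x' + u - h \<in> X1"
      by (simp add: ker_on_def)
    from subspace_add[OF X1(1) subspace_add[OF X1(1) this h(1)] x'(1)]
    have "x + u \<in> X1" by (simp add: algebra_simps)
    from infdist_le[OF this, of x] small show False
      by (simp add: dist_norm)
  qed
  then show ?thesis
    using d by (intro exI[of _ "ball x0 (d / 3)"]) auto
qed

end
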